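(* Let $\alpha:[0,1]\to[0,\infty)$ be measurable with $\alpha(t)>0$ for almost every $t\in[0,1]$. The mapping $R^{\alpha(\cdot)}$ is bounded in $L_1[0,1]$ if and only if $$\sup_{0\le s\le 1}\int_s^1\frac{1}{\Gamma(\alpha(t))}(t-s)^{\alpha(t)-1}\,dt<\infty .$$ Moreover, in this case $$\|R^{\alpha(\cdot)}:L_1[0,1]\to L_1[0,1]\|=\sup_{0\le s\le 1}\int_s^1\frac{1}{\Gamma(\alpha(t))}(t-s)^{\alpha(t)-1}\,dt .$$
   Context: For a measurable function $\alpha:[0,1]\to[0,\infty)$ with $\alpha(t)>0$ for almost every $t$, the Riemann--Liouville operator of variable order is $$(R^{\alpha(\cdot)}f)(t):=\frac{1}{\Gamma(\alpha(t))}\int_0^t (t-s)^{\alpha(t)-1}f(s)\,ds,\qquad t\in[0,1],$$ for $f\in L_1[0,1]$ (the integral exists for almost every $t$). "Bounded in $L_1[0,1]$" means that it is a bounded linear operator from $L_1[0,1]$ to $L_1[0,1]$. *)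

theory Defs
  imports "HOL-Analysis.Analysis"
begin

abbreviation leb01 :: "real measure" where
  "leb01 \<equiv> lebesgue_on {0..1}"

text \<open>
  Elements of $L_1[0,1]$ are represented by Lebesgue integrable functions; functions that agree
  almost everywhere on $[0,1]$ represent the same element, and values outside $[0,1]$ are
  irrelevant. Accordingly, the norm below is a seminorm on representatives and the linearity
  of an operator is required up to null sets. A bounded linear operator in the sense of
  \<open>bounded_linear_L1\<close> maps representatives of the same element to representatives of the same
  element, because it maps functions of norm zero to functions of norm zero.
\<close>

definition L1 :: "(real \<Rightarrow> real) set" where
  "L1 = {f. integrable leb01 f}"

definition L1_norm :: "(real \<Rightarrow> real) \<Rightarrow> real" where
  "L1_norm f = (LINT t|leb01. \<bar>f t\<bar>)"

definition bounded_linear_L1 :: "((real \<Rightarrow> real) \<Rightarrow> real \<Rightarrow> real) \<Rightarrow> bool" where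
  "bounded_linear_L1 T \<longleftrightarrow>
     (\<forall>f\<in>L1. T f \<in> L1) \<and>
     (\<forall>f\<in>L1. \<forall>g\<in>L1. AE t in leb01. T (\<lambda>s. f s + g s) t = T f t + T g t) \<and>
     (\<forall>c. \<forall>f\<in>L1. AE t in leb01. T (\<lambda>s. c * f s) t = c * T f t) \<and>
     (\<exists>C. \<forall>f\<in>L1. L1_norm (T f) \<le> C * L1_norm f)"

text \<open>The real supremum is meaningful only for operators satisfying \<open>bounded_linear_L1\<close>.\<close>

definition onorm_L1 :: "((real \<Rightarrow> real) \<Rightarrow> real \<Rightarrow> real) \<Rightarrow> real" where
  "onorm_L1 T = (SUP f\<in>{f\<in>L1. L1_norm f \<le> 1}. L1_norm (T f))"

text \<open>
  The Riemann--Liouville operator of variable order. For $f \in L_1[0,1]$ the integral exists for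
  almost every $t$; on the exceptional null set the Bochner integral has the default value 0.
  The null set where $\alpha(t) = 0$ is covered by the conventions \<open>Gamma 0 = 0\<close> and \<open>1 / 0 = 0\<close>.
\<close>

definition RL :: "(real \<Rightarrow> real) \<Rightarrow> (real \<Rightarrow> real) \<Rightarrow> real \<Rightarrow> real" where
  "RL \<alpha> f t = 1 / Gamma (\<alpha> t) * (LINT s:{0..t}|lebesgue. (t - s) powr (\<alpha> t - 1) * f s)"

text \<open>
  The integrand is nonnegative for $\alpha(t) \ge 0$, so \<open>ennreal\<close> does not truncate it, and the
  supremum is taken in $[0,\infty]$.
\<close>

definition RL_sup :: "(real \<Rightarrow> real) \<Rightarrow> ennreal" where
  "RL_sup \<alpha> = (SUP s\<in>{0..1}. \<integral>\<^sup>+t\<in>{s..1}. ennreal (1 / Gamma (\<alpha> t) * (t - s) powr (\<alpha> t - 1)) \<partial>lebesgue)"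

end

theory Submission
  imports Defs
begin

text \<open>
  The operator is an integral operator with the nonnegative kernel
  $K(t,s) = (t-s)^{\alpha(t)-1}/\Gamma(\alpha(t))$ for $s \le t$ and $K(t,s) = 0$ otherwise, and the
  claim is that its norm on $L_1$ is the supremum of the column integrals $k(s) = \int_0^1 K(t,s)\,dt$.

  If the supremum is finite, Tonelli's theorem (\<open>nn_integral_RL_kernel_le\<close>) gives
  $\int\int K(t,s)|f(s)|\,ds\,dt = \int k(s)|f(s)|\,ds \le (\sup k)\,\|f\|$. Hence the defining integral
  converges absolutely for almost every $t$, which yields linearity almost everywhere, and the norm is at
  most the supremum.

  Conversely, the supremum is taken over every $s$ and not just almost every $s$, so each column has to be
  tested individually. For $s < 1$ the normalised indicators $f_n$ of the intervals $[s, s + h_n]$ with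
  $h_n \to 0$ have norm one. For $t > s$ the kernel is monotone and continuous in its second argument
  near $s$, so the average of $K(t,\cdot)$ over the interval is eventually at least
  $\min(K(t,s), K(t,s+h_n))$, which tends to $K(t,s)$ (\<open>kernel_le_liminf_RL\<close>).
  Fatou's lemma then bounds $k(s)$ by the operator norm (\<open>kernel_column_le\<close>).
\<close>

section \<open>The kernel of the operator\<close>

text \<open>
  The factor $1/\Gamma$ is written as \<open>rGamma\<close>, which is continuous on the whole line and
  vanishes at 0; rows with $\alpha(t) = 0$ are therefore zero. The case distinction is needed because
  \<open>powr\<close> with a negative base does not vanish.
\<close>

definition RL_kernel :: "(real \<Rightarrow> real) \<Rightarrow> real \<Rightarrow> real \<Rightarrow> real" where
  "RL_kernel \<alpha> t s = (if s \<le> t then rGamma (\<alpha> t) * (t - s) powr (\<alpha> t - 1) else 0)"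

lemma rGamma_real_nonneg: "x \<ge> 0 \<Longrightarrow> rGamma (x::real) \<ge> 0"
  by (cases "x = 0") (auto simp: rGamma_inverse_Gamma intro: less_imp_le)

lemma RL_kernel_nonneg: "\<alpha> t \<ge> 0 \<Longrightarrow> RL_kernel \<alpha> t s \<ge> 0"
  by (simp add: RL_kernel_def rGamma_real_nonneg)

text \<open>
  No integrability of \<open>f\<close> is needed. If \<open>rGamma (\<alpha> t) \<noteq> 0\<close>, then the two integrands are both
  integrable or both not, and in the latter case both integrals are 0; if \<open>rGamma (\<alpha> t) = 0\<close>, then
  both sides are 0.
\<close>

lemma RL_eq_kernel_integral:
  assumes "t \<in> {0..1}"
  shows "RL \<alpha> f t = (LINT s|leb01. RL_kernel \<alpha> t s * f s)"
proof -
  have "(LINT s|leb01. RL_kernel \<alpha> t s * f s)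
      = (LINT s|lebesgue. indicator {0..1} s *\<^sub>R (RL_kernel \<alpha> t s * f s))"
    by (simp add: integral_restrict_space)
  also have "\<dots> = (LINT s|lebesgue. rGamma (\<alpha> t) * (indicator {0..t} s *\<^sub>R ((t - s) powr (\<alpha> t - 1) * f s)))"
    using assms
    by (intro Bochner_Integration.integral_cong) (auto simp: RL_kernel_def indicator_def)
  also have "\<dots> = RL \<alpha> f t"
    by (simp only: RL_def set_lebesgue_integral_def rGamma_inverse_Gamma inverse_eq_divide
        integral_mult_right_zero)
  finally show ?thesis by simp
qed

lemma nn_integral_kernel_column:
  assumes "s \<in> {0..1}"
  shows "(\<integral>\<^sup>+t\<in>{s..1}. ennreal (1 / Gamma (\<alpha> t) * (t - s) powr (\<alpha> t - 1)) \<partial>lebesgue)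
       = (\<integral>\<^sup>+t. ennreal (RL_kernel \<alpha> t s) \<partial>leb01)"
proof -
  have "(\<integral>\<^sup>+t. ennreal (RL_kernel \<alpha> t s) \<partial>leb01)
      = (\<integral>\<^sup>+t. ennreal (RL_kernel \<alpha> t s) * indicator {0..1} t \<partial>lebesgue)"
    by (simp add: nn_integral_restrict_space)
  also have "\<dots> = (\<integral>\<^sup>+t\<in>{s..1}. ennreal (1 / Gamma (\<alpha> t) * (t - s) powr (\<alpha> t - 1)) \<partial>lebesgue)"
    using assms
    by (intro nn_integral_cong)
       (auto simp: RL_kernel_def indicator_def rGamma_inverse_Gamma inverse_eq_divide)
  finally show ?thesis by simp
qed

lemma RL_sup_eq: "RL_sup \<alpha> = (SUP s\<in>{0..1}. \<integral>\<^sup>+t. ennreal (RL_kernel \<alpha> t s) \<partial>leb01)"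
  unfolding RL_sup_def by (intro SUP_cong refl nn_integral_kernel_column)

lemma pair_sigma_finite_leb01: "pair_sigma_finite leb01 leb01"
proof -
  interpret finite_measure leb01 by (intro finite_measure_lebesgue_on) simp
  show ?thesis by unfold_locales
qed

lemma measurable_RL_kernel:
  assumes [measurable]: "\<alpha> \<in> borel_measurable leb01"
  shows "(\<lambda>(t, s). RL_kernel \<alpha> t s) \<in> borel_measurable (leb01 \<Otimes>\<^sub>M leb01)"
proof -
  have [measurable]: "(\<lambda>x. x) \<in> borel_measurable leb01"
    by (intro continuous_imp_measurable_on_sets_lebesgue continuous_on_id) simp
  have [measurable]: "rGamma \<in> borel_measurable (borel :: real measure)"
    by (intro borel_measurable_continuous_onI continuous_on_rGamma)
  have [measurable]: "fst \<in> borel_measurable (leb01 \<Otimes>\<^sub>M leb01)" "snd \<in> borel_measurable (leb01 \<Otimes>\<^sub>M leb01)"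
    using measurable_compose[OF measurable_fst, of "\<lambda>x. x" leb01 borel leb01]
      measurable_compose[OF measurable_snd, of "\<lambda>x. x" leb01 borel leb01] by simp_all
  show ?thesis
    unfolding RL_kernel_def case_prod_beta by measurable
qed

section \<open>Boundedness from finite column integrals\<close>

lemma nn_integral_RL_kernel_le:
  assumes [measurable]: "\<alpha> \<in> borel_measurable leb01"
    and f: "f \<in> L1"
  shows "(\<integral>\<^sup>+t. \<integral>\<^sup>+s. ennreal (RL_kernel \<alpha> t s) * ennreal \<bar>f s\<bar> \<partial>leb01 \<partial>leb01)
       \<le> RL_sup \<alpha> * ennreal (L1_norm f)"
proof -
  interpret pair_sigma_finite leb01 leb01 by (rule pair_sigma_finite_leb01)
  have int: "integrable leb01 f" using f by (simp add: L1_def)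
  note [measurable] = measurable_RL_kernel[OF assms(1)] borel_measurable_integrable[OF int]
  have "(\<integral>\<^sup>+t. \<integral>\<^sup>+s. ennreal (RL_kernel \<alpha> t s) * ennreal \<bar>f s\<bar> \<partial>leb01 \<partial>leb01)
      = (\<integral>\<^sup>+s. \<integral>\<^sup>+t. ennreal (RL_kernel \<alpha> t s) * ennreal \<bar>f s\<bar> \<partial>leb01 \<partial>leb01)"
    by (rule Fubini'[symmetric]) measurable
  also have "\<dots> = (\<integral>\<^sup>+s. (\<integral>\<^sup>+t. ennreal (RL_kernel \<alpha> t s) \<partial>leb01) * ennreal \<bar>f s\<bar> \<partial>leb01)"
    by (intro nn_integral_cong nn_integral_multc) measurable
  also have "\<dots> \<le> (\<integral>\<^sup>+s. RL_sup \<alpha> * ennreal \<bar>f s\<bar> \<partial>leb01)"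
    by (intro nn_integral_mono mult_right_mono) (auto simp: RL_sup_eq intro: SUP_upper)
  also have "\<dots> = RL_sup \<alpha> * ennreal (L1_norm f)"
    using int by (simp add: nn_integral_cmult nn_integral_eq_integral L1_norm_def)
  finally show ?thesis .
qed

text \<open>Integrability is not assumed; the integral of a non-integrable function is 0.\<close>

lemma ennreal_abs_integral_le:
  fixes g :: "'a \<Rightarrow> real"
  shows "ennreal \<bar>LINT x|M. g x\<bar> \<le> (\<integral>\<^sup>+x. ennreal \<bar>g x\<bar> \<partial>M)"
proof (cases "integrable M g")
  case True
  then show ?thesis using integral_norm_bound_ennreal[OF True] by simp
qed (simp add: not_integrable_integral_eq)

lemma AE_integrable_RL_kernel:
  assumes \<alpha>: "\<alpha> \<in> borel_measurable leb01"
    and nonneg: "\<forall>t\<in>{0..1}. \<alpha> t \<ge> 0"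
    and fin: "RL_sup \<alpha> < \<infinity>" and f: "f \<in> L1"
  shows "AE t in leb01. integrable leb01 (\<lambda>s. RL_kernel \<alpha> t s * f s)"
proof -
  interpret pair_sigma_finite leb01 leb01 by (rule pair_sigma_finite_leb01)
  note [measurable] = measurable_RL_kernel[OF \<alpha>]
  have [measurable]: "f \<in> borel_measurable leb01" using f by (auto simp: L1_def)
  have meas: "(\<lambda>t. \<integral>\<^sup>+s. ennreal (RL_kernel \<alpha> t s) * ennreal \<bar>f s\<bar> \<partial>leb01) \<in> borel_measurable leb01"
    by measurable
  have "RL_sup \<alpha> * ennreal (L1_norm f) < \<infinity>"
    using fin by (simp add: ennreal_mult_less_top)
  then have "(\<integral>\<^sup>+t. \<integral>\<^sup>+s. ennreal (RL_kernel \<alpha> t s) * ennreal \<bar>f s\<bar> \<partial>leb01 \<partial>leb01) \<noteq> \<infinity>"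
    using nn_integral_RL_kernel_le[OF \<alpha> f] by auto
  then have "AE t in leb01. (\<integral>\<^sup>+s. ennreal (RL_kernel \<alpha> t s) * ennreal \<bar>f s\<bar> \<partial>leb01) \<noteq> \<infinity>"
    by (intro nn_integral_noteq_infinite meas)
  then show ?thesis
  proof (rule AE_mp, intro AE_I2 impI)
    fix t assume t: "t \<in> space leb01"
      and fin_t: "(\<integral>\<^sup>+s. ennreal (RL_kernel \<alpha> t s) * ennreal \<bar>f s\<bar> \<partial>leb01) \<noteq> \<infinity>"
    have K: "(\<lambda>s. RL_kernel \<alpha> t s) \<in> borel_measurable leb01"
      using measurable_Pair2[OF measurable_RL_kernel[OF \<alpha>] t] by simp
    have "RL_kernel \<alpha> t s \<ge> 0" for s
      using t nonneg by (intro RL_kernel_nonneg) simp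
    then have "(\<integral>\<^sup>+s. ennreal (norm (RL_kernel \<alpha> t s * f s)) \<partial>leb01) < \<infinity>"
      using fin_t by (simp add: abs_mult ennreal_mult less_top)
    then show "integrable leb01 (\<lambda>s. RL_kernel \<alpha> t s * f s)"
      using K \<open>f \<in> borel_measurable leb01\<close>
      by (intro integrableI_bounded borel_measurable_times)
  qed
qed

lemma RL_bound:
  assumes \<alpha>: "\<alpha> \<in> borel_measurable leb01"
    and nonneg: "\<forall>t\<in>{0..1}. \<alpha> t \<ge> 0"
    and fin: "RL_sup \<alpha> < \<infinity>" and f: "f \<in> L1"
  shows "RL \<alpha> f \<in> L1" "L1_norm (RL \<alpha> f) \<le> enn2real (RL_sup \<alpha>) * L1_norm f"
proof -
  interpret pair_sigma_finite leb01 leb01 by (rule pair_sigma_finite_leb01)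
  note [measurable] = measurable_RL_kernel[OF \<alpha>]
  have [measurable]: "f \<in> borel_measurable leb01" using f by (auto simp: L1_def)
  have "(\<lambda>t. LINT s|leb01. RL_kernel \<alpha> t s * f s) \<in> borel_measurable leb01"
    by measurable
  then have meas: "RL \<alpha> f \<in> borel_measurable leb01"
    by (subst measurable_cong[where g = "\<lambda>t. LINT s|leb01. RL_kernel \<alpha> t s * f s"])
       (auto simp: RL_eq_kernel_integral)
  have "(\<integral>\<^sup>+t. ennreal (norm (RL \<alpha> f t)) \<partial>leb01)
      \<le> (\<integral>\<^sup>+t. \<integral>\<^sup>+s. ennreal (RL_kernel \<alpha> t s) * ennreal \<bar>f s\<bar> \<partial>leb01 \<partial>leb01)"
  proof (rule nn_integral_mono)
    fix t assume "t \<in> space leb01"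
    then have t: "t \<in> {0..1}" by simp
    have "ennreal (norm (RL \<alpha> f t)) \<le> (\<integral>\<^sup>+s. ennreal \<bar>RL_kernel \<alpha> t s * f s\<bar> \<partial>leb01)"
      using ennreal_abs_integral_le by (simp add: RL_eq_kernel_integral[OF t])
    also have "\<dots> = (\<integral>\<^sup>+s. ennreal (RL_kernel \<alpha> t s) * ennreal \<bar>f s\<bar> \<partial>leb01)"
      using RL_kernel_nonneg[of \<alpha> t] nonneg t by (simp add: abs_mult ennreal_mult)
    finally show "ennreal (norm (RL \<alpha> f t))
      \<le> (\<integral>\<^sup>+s. ennreal (RL_kernel \<alpha> t s) * ennreal \<bar>f s\<bar> \<partial>leb01)" .
  qed
  also have "\<dots> \<le> RL_sup \<alpha> * ennreal (L1_norm f)"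
    by (rule nn_integral_RL_kernel_le[OF \<alpha> f])
  also have "\<dots> = ennreal (enn2real (RL_sup \<alpha>) * L1_norm f)"
    using fin by (simp add: ennreal_mult' L1_norm_def)
  finally have le: "(\<integral>\<^sup>+t. ennreal (norm (RL \<alpha> f t)) \<partial>leb01)
      \<le> ennreal (enn2real (RL_sup \<alpha>) * L1_norm f)" .
  have int: "integrable leb01 (RL \<alpha> f)"
    using meas le by (intro integrableI_bounded) (auto simp: le_less_trans[OF _ ennreal_less_top])
  then show "RL \<alpha> f \<in> L1" by (simp add: L1_def)
  have "ennreal (L1_norm (RL \<alpha> f)) \<le> ennreal (enn2real (RL_sup \<alpha>) * L1_norm f)"
    using le int by (simp add: nn_integral_eq_integral L1_norm_def)
  then show "L1_norm (RL \<alpha> f) \<le> enn2real (RL_sup \<alpha>) * L1_norm f"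
    by (simp add: L1_norm_def)
qed

lemma RL_bounded_if_RL_sup_finite:
  assumes \<alpha>: "\<alpha> \<in> borel_measurable leb01"
    and nonneg: "\<forall>t\<in>{0..1}. \<alpha> t \<ge> 0"
    and fin: "RL_sup \<alpha> < \<infinity>"
  shows "bounded_linear_L1 (RL \<alpha>)"
  unfolding bounded_linear_L1_def
proof (intro conjI ballI allI)
  note AE_int = AE_integrable_RL_kernel[OF \<alpha> nonneg fin]
  show "AE t in leb01. RL \<alpha> (\<lambda>s. f s + g s) t = RL \<alpha> f t + RL \<alpha> g t"
    if "f \<in> L1" "g \<in> L1" for f g
    using AE_int[OF that(1)] AE_int[OF that(2)] AE_space
    by eventually_elim (simp add: RL_eq_kernel_integral distrib_left)
  show "AE t in leb01. RL \<alpha> (\<lambda>s. c * f s) t = c * RL \<alpha> f t" for c f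
    by (intro AE_I2) (simp add: RL_eq_kernel_integral mult.left_commute)
  show "\<exists>C. \<forall>f\<in>L1. L1_norm (RL \<alpha> f) \<le> C * L1_norm f"
    using RL_bound(2)[OF \<alpha> nonneg fin] by blast
qed (rule RL_bound(1)[OF \<alpha> nonneg fin])

section \<open>Column integrals are bounded by the operator norm\<close>

lemma interval_average:
  fixes s h :: real
  assumes "0 \<le> s" "h > 0" "s + h \<le> 1"
  shows "integrable leb01 (\<lambda>r. indicator {s..s+h} r / h)"
    and "(LINT r|leb01. indicator {s..s+h} r / h) = 1"
proof -
  have "has_bochner_integral leb01 (\<lambda>r. indicator {s..s+h} r :: real) h"
    using has_bochner_integral_real_indicator[of "{s..s+h}" leb01] assms
    by (auto simp: sets_restrict_space_iff emeasure_restrict_space measure_restrict_space)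
  then have "has_bochner_integral leb01 (\<lambda>r. indicator {s..s+h} r / h) 1"
    using has_bochner_integral_divide_zero[of h leb01 _ h] assms(2) by fastforce
  then show "integrable leb01 (\<lambda>r. indicator {s..s+h} r / h)"
    and "(LINT r|leb01. indicator {s..s+h} r / h) = 1"
    by (auto simp: has_bochner_integral_iff)
qed

text \<open>
  A power is increasing or decreasing according to the sign of its exponent; taking the minimum and
  the maximum of the endpoint values covers both cases.
\<close>

lemma powr_between:
  fixes x y z a :: real
  assumes "0 < x" "x \<le> y" "y \<le> z"
  shows "min (x powr a) (z powr a) \<le> y powr a" "y powr a \<le> max (x powr a) (z powr a)"
proof -
  have "x powr a \<le> y powr a \<and> y powr a \<le> z powr a \<or> z powr a \<le> y powr a \<and> y powr a \<le> x powr a"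
  proof (cases "a \<ge> 0")
    case True
    then show ?thesis using assms by (auto intro!: powr_mono2)
  next
    case False
    then show ?thesis using assms by (auto intro!: powr_mono2')
  qed
  then show "min (x powr a) (z powr a) \<le> y powr a" "y powr a \<le> max (x powr a) (z powr a)"
    by auto
qed

text \<open>
  The assumption \<open>s + h < t\<close> keeps the interval away from the possible singularity at \<open>t\<close>, so that
  the integrand is bounded and the integral is not a default value.
\<close>

lemma RL_interval_average_ge:
  assumes \<alpha>: "\<alpha> \<in> borel_measurable leb01" and nonneg: "\<alpha> t \<ge> 0"
    and "0 \<le> s" "h > 0" "s + h < t" "t \<le> 1"
  shows "min (RL_kernel \<alpha> t s) (RL_kernel \<alpha> t (s + h)) \<le> RL \<alpha> (\<lambda>r. indicator {s..s+h} r / h) t"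
proof -
  let ?m = "min (RL_kernel \<alpha> t s) (RL_kernel \<alpha> t (s + h))"
  let ?M = "max (RL_kernel \<alpha> t s) (RL_kernel \<alpha> t (s + h))"
  let ?f = "\<lambda>r. indicator {s..s+h} r / h"
  have t: "t \<in> {0..1}" using assms by simp
  have f: "integrable leb01 ?f" "(LINT r|leb01. ?f r) = 1"
    using interval_average[of s h] assms by auto
  have K: "(\<lambda>r. RL_kernel \<alpha> t r) \<in> borel_measurable leb01"
    using measurable_Pair2[OF measurable_RL_kernel[OF \<alpha>], of t] t by simp
  have between: "?m \<le> RL_kernel \<alpha> t r" "RL_kernel \<alpha> t r \<le> ?M" if r: "r \<in> {s..s+h}" for r
  proof -
    let ?p = "\<lambda>r. (t - r) powr (\<alpha> t - 1)" and ?c = "rGamma (\<alpha> t)"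
    have c: "?c \<ge> 0" by (rule rGamma_real_nonneg[OF nonneg])
    have K: "RL_kernel \<alpha> t s = ?c * ?p s" "RL_kernel \<alpha> t (s + h) = ?c * ?p (s + h)"
      "RL_kernel \<alpha> t r = ?c * ?p r"
      using r assms by (auto simp: RL_kernel_def)
    have mM: "?m = ?c * min (?p (s + h)) (?p s)" "?M = ?c * max (?p (s + h)) (?p s)"
      using c by (simp_all add: K min_mult_distrib_left max_mult_distrib_left min.commute max.commute)
    have p: "min (?p (s + h)) (?p s) \<le> ?p r" "?p r \<le> max (?p (s + h)) (?p s)"
      using powr_between[of "t - (s + h)" "t - r" "t - s" "\<alpha> t - 1"] r assms by auto
    show "?m \<le> RL_kernel \<alpha> t r" "RL_kernel \<alpha> t r \<le> ?M"
      unfolding mM unfolding K using p c by (auto intro!: mult_left_mono)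
  qed
  have int: "integrable leb01 (\<lambda>r. RL_kernel \<alpha> t r * ?f r)"
  proof (rule Bochner_Integration.integrable_bound)
    show "integrable leb01 (\<lambda>r. ?M * ?f r)"
      using f(1) by (rule integrable_mult_right)
    show "(\<lambda>r. RL_kernel \<alpha> t r * ?f r) \<in> borel_measurable leb01"
      using K f(1) by (intro borel_measurable_times) auto
    show "AE r in leb01. norm (RL_kernel \<alpha> t r * ?f r) \<le> norm (?M * ?f r)"
    proof (intro AE_I2)
      fix r
      show "norm (RL_kernel \<alpha> t r * ?f r) \<le> norm (?M * ?f r)"
        using between(2)[of r] RL_kernel_nonneg[of \<alpha> t r] nonneg \<open>h > 0\<close>
        by (cases "r \<in> {s..s+h}") (auto simp: divide_right_mono)
    qed
  qed
  have "?m = (LINT r|leb01. ?m * ?f r)" using f by simp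
  also have "\<dots> \<le> (LINT r|leb01. RL_kernel \<alpha> t r * ?f r)"
  proof (rule integral_mono)
    show "integrable leb01 (\<lambda>r. ?m * ?f r)" using f(1) by (rule integrable_mult_right)
    show "?m * ?f r \<le> RL_kernel \<alpha> t r * ?f r" for r
      using between(1)[of r] \<open>h > 0\<close>
      by (cases "r \<in> {s..s+h}") (auto simp: divide_right_mono)
  qed (rule int)
  also have "\<dots> = RL \<alpha> ?f t" by (simp add: RL_eq_kernel_integral[OF t])
  finally show ?thesis .
qed

lemma kernel_le_liminf_RL:
  fixes h :: "nat \<Rightarrow> real"
  assumes \<alpha>: "\<alpha> \<in> borel_measurable leb01" and nonneg: "\<alpha> t \<ge> 0"
    and "0 \<le> s" "t \<le> 1" and h: "\<And>n. h n > 0" "h \<longlonglongrightarrow> 0"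
  shows "ennreal (RL_kernel \<alpha> t s)
       \<le> liminf (\<lambda>n. ennreal (RL \<alpha> (\<lambda>r. indicator {s..s + h n} r / h n) t))"
proof (cases "s < t")
  case False
  \<comment> \<open>on the diagonal this relies on \<open>0 powr a = 0\<close>\<close>
  then have "RL_kernel \<alpha> t s = 0" by (simp add: RL_kernel_def)
  then show ?thesis by simp
next
  case True
  have sh: "(\<lambda>n. s + h n) \<longlonglongrightarrow> s" using tendsto_add[OF tendsto_const h(2), of s] by simp
  have ev: "\<forall>\<^sub>F n in sequentially. s + h n < t" using order_tendstoD(2)[OF sh True] .
  have "(\<lambda>n. rGamma (\<alpha> t) * (t - (s + h n)) powr (\<alpha> t - 1)) \<longlonglongrightarrow> rGamma (\<alpha> t) * (t - s) powr (\<alpha> t - 1)"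
    using True by (intro tendsto_intros sh) auto
  moreover have "\<forall>\<^sub>F n in sequentially.
      rGamma (\<alpha> t) * (t - (s + h n)) powr (\<alpha> t - 1) = RL_kernel \<alpha> t (s + h n)"
    by (rule eventually_mono[OF ev]) (simp add: RL_kernel_def)
  moreover have "rGamma (\<alpha> t) * (t - s) powr (\<alpha> t - 1) = RL_kernel \<alpha> t s"
    using True by (simp add: RL_kernel_def)
  ultimately have "(\<lambda>n. RL_kernel \<alpha> t (s + h n)) \<longlonglongrightarrow> RL_kernel \<alpha> t s"
    using Lim_transform_eventually by fastforce
  then have "(\<lambda>n. min (RL_kernel \<alpha> t s) (RL_kernel \<alpha> t (s + h n))) \<longlonglongrightarrow> RL_kernel \<alpha> t s"
    using tendsto_min[OF tendsto_const, of _ "RL_kernel \<alpha> t s" sequentially "RL_kernel \<alpha> t s"] by simp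
  then have "ennreal (RL_kernel \<alpha> t s)
      = liminf (\<lambda>n. ennreal (min (RL_kernel \<alpha> t s) (RL_kernel \<alpha> t (s + h n))))"
    by (intro lim_imp_Liminf[symmetric] tendsto_ennrealI) auto
  also have "\<dots> \<le> liminf (\<lambda>n. ennreal (RL \<alpha> (\<lambda>r. indicator {s..s + h n} r / h n) t))"
    using ev by (intro Liminf_mono eventually_mono[OF ev] ennreal_leI RL_interval_average_ge)
      (use assms in auto)
  finally show ?thesis .
qed

text \<open>
  It suffices that \<open>B\<close> bounds the images of the unit ball. The bound holds for every \<open>s\<close>, because
  the functions tested concentrate at \<open>s\<close> from the right; at \<open>s = 1\<close> there is no room for them, but
  that column vanishes.
\<close>

lemma kernel_column_le:
  assumes \<alpha>: "\<alpha> \<in> borel_measurable leb01"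
    and nonneg: "\<forall>t\<in>{0..1}. \<alpha> t \<ge> 0"
    and L1: "\<And>f. f \<in> L1 \<Longrightarrow> RL \<alpha> f \<in> L1"
    and B: "\<And>f. f \<in> L1 \<Longrightarrow> L1_norm f \<le> 1 \<Longrightarrow> L1_norm (RL \<alpha> f) \<le> B"
    and s: "s \<in> {0..1}"
  shows "(\<integral>\<^sup>+t. ennreal (RL_kernel \<alpha> t s) \<partial>leb01) \<le> ennreal B"
proof (cases "s = 1")
  case True
  then have "(\<integral>\<^sup>+t. ennreal (RL_kernel \<alpha> t s) \<partial>leb01) = (\<integral>\<^sup>+t. 0 \<partial>leb01)"
    by (intro nn_integral_cong) (auto simp: RL_kernel_def)
  then show ?thesis by simp
next
  case False
  define h where "h n = (1 - s) / real (Suc n)" for n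
  define f where "f n = (\<lambda>r. indicator {s..s + h n} r / h n)" for n
  have h: "h n > 0" "s + h n \<le> 1" for n
  proof -
    show "h n > 0" using s False by (simp add: h_def)
    have "(1 - s) / real (Suc n) \<le> (1 - s) / 1"
      using s by (intro divide_left_mono) auto
    then show "s + h n \<le> 1" by (simp add: h_def)
  qed
  have h0: "h \<longlonglongrightarrow> 0"
    unfolding h_def using LIMSEQ_Suc[OF lim_const_over_n[of "1 - s"]] by simp
  have f: "f n \<in> L1" "L1_norm (f n) \<le> 1" for n
    using interval_average[of s "h n"] s h[of n] by (auto simp: f_def L1_def L1_norm_def)
  have int: "integrable leb01 (RL \<alpha> (f n))" for n
    using L1[OF f(1)] by (simp add: L1_def)
  have "(\<integral>\<^sup>+t. ennreal (RL_kernel \<alpha> t s) \<partial>leb01)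
      \<le> (\<integral>\<^sup>+t. liminf (\<lambda>n. ennreal (RL \<alpha> (f n) t)) \<partial>leb01)"
    using s h h0 by (intro nn_integral_mono) (auto simp: f_def intro!: kernel_le_liminf_RL[OF \<alpha>] bspec[OF nonneg])
  also have "\<dots> \<le> liminf (\<lambda>n. \<integral>\<^sup>+t. ennreal (RL \<alpha> (f n) t) \<partial>leb01)"
    using int by (intro nn_integral_liminf) auto
  also have "\<dots> \<le> liminf (\<lambda>n::nat. ennreal B)"
  proof (intro Liminf_mono always_eventually allI)
    fix n
    have "(\<integral>\<^sup>+t. ennreal (RL \<alpha> (f n) t) \<partial>leb01) \<le> (\<integral>\<^sup>+t. ennreal \<bar>RL \<alpha> (f n) t\<bar> \<partial>leb01)"
      by (intro nn_integral_mono ennreal_leI) auto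
    also have "\<dots> = ennreal (L1_norm (RL \<alpha> (f n)))"
      using int by (simp add: nn_integral_eq_integral L1_norm_def)
    also have "\<dots> \<le> ennreal B" by (intro ennreal_leI B f)
    finally show "(\<integral>\<^sup>+t. ennreal (RL \<alpha> (f n) t) \<partial>leb01) \<le> ennreal B" .
  qed
  also have "\<dots> = ennreal B" by (simp add: Liminf_const)
  finally show ?thesis .
qed

text \<open>Boundedness ensures that the set in the definition of \<open>onorm_L1\<close> is bounded above.\<close>

lemma L1_norm_le_onorm_L1:
  assumes T: "bounded_linear_L1 T" and f: "f \<in> L1" "L1_norm f \<le> 1"
  shows "L1_norm (T f) \<le> onorm_L1 T"
proof -
  obtain C where C: "\<And>f. f \<in> L1 \<Longrightarrow> L1_norm (T f) \<le> C * L1_norm f"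
    using T unfolding bounded_linear_L1_def by blast
  have "L1_norm (T g) \<le> \<bar>C\<bar>" if "g \<in> L1" "L1_norm g \<le> 1" for g
  proof -
    have g0: "L1_norm g \<ge> 0" by (simp add: L1_norm_def)
    have "L1_norm (T g) \<le> C * L1_norm g" by (rule C) fact
    also have "\<dots> \<le> \<bar>C\<bar> * 1" using that g0 by (intro mult_mono) auto
    finally show ?thesis by simp
  qed
  then have "bdd_above ((\<lambda>f. L1_norm (T f)) ` {f\<in>L1. L1_norm f \<le> 1})"
    by (intro bdd_aboveI2[of _ _ "\<bar>C\<bar>"]) auto
  then show ?thesis unfolding onorm_L1_def using f by (intro cSUP_upper) auto
qed

section \<open>The operator norm\<close>

lemma RL_sup_le_onorm_L1:
  assumes \<alpha>: "\<alpha> \<in> borel_measurable leb01"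
    and nonneg: "\<forall>t\<in>{0..1}. \<alpha> t \<ge> 0"
    and RL: "bounded_linear_L1 (RL \<alpha>)"
  shows "RL_sup \<alpha> \<le> ennreal (onorm_L1 (RL \<alpha>))"
  unfolding RL_sup_eq
proof (rule SUP_least)
  fix s :: real assume "s \<in> {0..1}"
  then show "(\<integral>\<^sup>+t. ennreal (RL_kernel \<alpha> t s) \<partial>leb01) \<le> ennreal (onorm_L1 (RL \<alpha>))"
    using RL by (intro kernel_column_le[OF \<alpha> nonneg] L1_norm_le_onorm_L1[OF RL])
      (auto simp: bounded_linear_L1_def)
qed

lemma onorm_L1_RL_le:
  assumes \<alpha>: "\<alpha> \<in> borel_measurable leb01"
    and nonneg: "\<forall>t\<in>{0..1}. \<alpha> t \<ge> 0"
    and fin: "RL_sup \<alpha> < \<infinity>"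
  shows "onorm_L1 (RL \<alpha>) \<le> enn2real (RL_sup \<alpha>)"
  unfolding onorm_L1_def
proof (rule cSUP_least)
  have "(\<lambda>_. 0) \<in> {f \<in> L1. L1_norm f \<le> 1}" by (simp add: L1_def L1_norm_def)
  then show "{f \<in> L1. L1_norm f \<le> 1} \<noteq> {}" by blast
  fix f assume f: "f \<in> {f \<in> L1. L1_norm f \<le> 1}"
  then have "L1_norm (RL \<alpha> f) \<le> enn2real (RL_sup \<alpha>) * L1_norm f"
    using RL_bound(2)[OF \<alpha> nonneg fin] by simp
  also have "\<dots> \<le> enn2real (RL_sup \<alpha>) * 1"
    using f by (intro mult_left_mono) auto
  finally show "L1_norm (RL \<alpha> f) \<le> enn2real (RL_sup \<alpha>)" by simp
qed

theorem proposition3p2: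
  fixes \<alpha> :: "real \<Rightarrow> real"
  assumes "\<alpha> \<in> borel_measurable (lebesgue_on {0..1})"
    and "\<And>t. t \<in> {0..1} \<Longrightarrow> \<alpha> t \<ge> 0"
    and "AE t in lebesgue_on {0..1}. \<alpha> t > 0"
  shows "(bounded_linear_L1 (RL \<alpha>) \<longleftrightarrow> RL_sup \<alpha> < \<infinity>) \<and>
         (bounded_linear_L1 (RL \<alpha>) \<longrightarrow> ennreal (onorm_L1 (RL \<alpha>)) = RL_sup \<alpha>)"
proof -
  have nonneg: "\<forall>t\<in>{0..1}. \<alpha> t \<ge> 0" using assms(2) by blast
  have sup_le: "RL_sup \<alpha> \<le> ennreal (onorm_L1 (RL \<alpha>))" if "bounded_linear_L1 (RL \<alpha>)"
    using RL_sup_le_onorm_L1[OF assms(1) nonneg that] .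
  have iff: "bounded_linear_L1 (RL \<alpha>) \<longleftrightarrow> RL_sup \<alpha> < \<infinity>"
    using sup_le RL_bounded_if_RL_sup_finite[OF assms(1) nonneg]
    by (auto intro: le_less_trans[OF _ ennreal_less_top])
  have "ennreal (onorm_L1 (RL \<alpha>)) \<le> RL_sup \<alpha>" if "RL_sup \<alpha> < \<infinity>"
  proof -
    have "ennreal (onorm_L1 (RL \<alpha>)) \<le> ennreal (enn2real (RL_sup \<alpha>))"
      using onorm_L1_RL_le[OF assms(1) nonneg that] by (intro ennreal_leI)
    also have "\<dots> = RL_sup \<alpha>" using that by simp
    finally show ?thesis .
  qed
  with iff sup_le show ?thesis by (auto intro: antisym)
qed

end
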